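(* Let $X=(\mathbb{C}^2\setminus\{0\})/\mathbb{Z}$ be the standard Hopf surface, where $1\in\mathbb{Z}$ acts by multiplication by $2$, with coordinates $(x_1,x_2)$ on $\mathbb{C}^2$ and $R^2=x_1\bar x_1+x_2\bar x_2$. Let $\mathbb{I}$ be the generalized complex structure on $TX\oplus T^*X$ with twist $$H=\frac1{R^4}\Big[(x_2d\bar x_2-\bar x_2dx_2)\wedge dx_1\wedge d\bar x_1+(x_1d\bar x_1-\bar x_1dx_1)\wedge dx_2\wedge d\bar x_2\Big]$$ whose $+i$-eigenbundle $L$ is the smooth extension to all of $X$ of the bundle $\{Y+\iota_YC: Y\in TX\otimes\mathbb{C}\}$ defined on $X\setminus\{x_2=0\}$, where $$C=\frac1{R^2}\Big(\frac{2x_1}{\bar x_2}\,d\bar x_1\wedge d\bar x_2+dx_1\wedge d\bar x_1+dx_2\wedge d\bar x_2\Big).$$ Let $c>0$ be a real number and let $S\subset X$ be the image in $X$ of the 2-sphere $\{(x_1,x_2): x_1\in\mathbb{R},\ R^2=c\}$. Then there is a unique rank-$0$ generalized complex brane in $(X,\mathbb{I})$ supported on $S$.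
   Context: The Courant algebroid on $X$ with twist a closed real 3-form $H$ is $TX\oplus T^*X$ with its canonical symmetric pairing and the bracket $[Y+\xi,Z+\eta]=[Y,Z]+\mathcal{L}_Y\eta-\iota_Zd\xi+\iota_Y\iota_ZH$. A generalized complex structure is a bundle map $\mathbb{I}$ with $\mathbb{I}^2=-1$, orthogonal for the pairing, whose $+i$-eigenbundle in the complexification is involutive for the bracket. The forms $C$ and $H$ are homogeneous of degree $0$ and hence descend to $X$ ($C$ away from $\{x_2=0\}$). On $X\setminus\{x_2=0\}$ one has $H=dC$, which is real. The bundle $L$ extends smoothly across $\{x_2=0\}$ and is the $+i$-eigenbundle of a generalized complex structure $\mathbb{I}$ on $X$ with twist $H$. For a submanifold $\iota:S\hookrightarrow X$, a Courant trivialization along $S$ is a real 2-form $F$ on $S$ with $dF=\iota^*H$. Its generalized tangent bundle is $\tau_S=\{Y+\xi\in(TX\oplus T^*X)|_S: Y\in TS,\ \iota^*\xi=\iota_YF\}$. A rank-$0$ generalized complex brane supported on $S$ is a Courant trivialization $F$ along $S$ with $\mathbb{I}\tau_S=\tau_S$. *)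

theory Defs
  imports "HOL-Analysis.Analysis"
begin

section \<open>Smooth maps between open subsets of normed spaces\<close>

text \<open>On an open set \<open>U\<close>, \<open>Ck_on k U f\<close> says that \<open>f\<close> is \<open>k\<close> times
  differentiable with continuous iterated directional derivatives of order \<open>k\<close>.\<close>

primrec Ck_on ::
  "nat \<Rightarrow> 'a::real_normed_vector set \<Rightarrow> ('a \<Rightarrow> 'b::real_normed_vector) \<Rightarrow> bool" where
  "Ck_on 0 U f \<longleftrightarrow> continuous_on U f"
| "Ck_on (Suc k) U f \<longleftrightarrow> (\<forall>x\<in>U. f differentiable (at x)) \<and>
     (\<forall>v. Ck_on k U (\<lambda>x. frechet_derivative f (at x) v))"

definition smooth_on ::
  "'a::real_normed_vector set \<Rightarrow> ('a \<Rightarrow> 'b::real_normed_vector) \<Rightarrow> bool" where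
  "smooth_on U f \<longleftrightarrow> (\<forall>k. Ck_on k U f)"


section \<open>Manifolds by local parametrizations\<close>

text \<open>A manifold with underlying set \<open>X :: 'p set\<close> is given by a family of local
  parametrizations \<open>(V, \<psi>)\<close>, with \<open>\<psi> : V \<rightarrow> X\<close> injective on an open set \<open>V\<close> of the model
  space; the inverses of the \<open>\<psi>\<close> are the charts.  A tensor field on the manifold is a family
  of local representatives, one on each \<open>V\<close>, which correspond under coordinate changes.\<close>

type_synonym ('p, 'e) patch = "'e set \<times> ('e \<Rightarrow> 'p)"

text \<open>The coordinate change \<open>\<psi>\<^sub>b\<inverse> \<circ> \<psi>\<^sub>a\<close>.  The model spaces may be different: for \<open>a\<close> a
  parametrization of a submanifold and \<open>b\<close> one of the ambient manifold, this is the inclusion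
  in local coordinates.\<close>

definition overlap :: "('p, 'd) patch \<Rightarrow> ('p, 'e) patch \<Rightarrow> 'd set" where
  "overlap a b = {y \<in> fst a. snd a y \<in> snd b ` fst b}"

definition change :: "('p, 'd) patch \<Rightarrow> ('p, 'e) patch \<Rightarrow> 'd \<Rightarrow> 'e" where
  "change a b y = inv_into (fst b) (snd b) (snd a y)"

definition dchange ::
  "('p, 'd::euclidean_space) patch \<Rightarrow> ('p, 'e::euclidean_space) patch \<Rightarrow> 'd \<Rightarrow> 'd \<Rightarrow> 'e" where
  "dchange a b y = frechet_derivative (change a b) (at y)"

definition smooth_atlas :: "('p, 'e::euclidean_space) patch set \<Rightarrow> 'p set \<Rightarrow> bool" where
  "smooth_atlas M X \<longleftrightarrow>
     (\<forall>a\<in>M. open (fst a) \<and> inj_on (snd a) (fst a)) \<and>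
     (\<Union>a\<in>M. snd a ` fst a) = X \<and>
     (\<forall>a\<in>M. \<forall>b\<in>M. open (overlap a b) \<and> smooth_on (overlap a b) (change a b))"

text \<open>All regular local parametrizations of an embedded submanifold \<open>S\<close> of dimension
  \<open>DIM('d)\<close>: the injective immersions from open sets of \<open>'d\<close> into the ambient manifold with
  image in \<open>S\<close>.  As the dimensions agree, such a map is automatically a diffeomorphism onto an
  open subset of \<open>S\<close>.\<close>

definition submanifold_patches ::
  "('p, 'e::euclidean_space) patch set \<Rightarrow> 'p set \<Rightarrow> ('p, 'd::euclidean_space) patch set" where
  "submanifold_patches M S = {b. open (fst b) \<and> inj_on (snd b) (fst b) \<and> snd b ` fst b \<subseteq> S \<and>
     (\<forall>a\<in>M. open (overlap b a) \<and> smooth_on (overlap b a) (change b a) \<and>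
        (\<forall>y \<in> overlap b a. inj (dchange b a y)))}"


section \<open>Differential forms\<close>

definition d2 ::
  "('e::real_normed_vector \<Rightarrow> 'e \<Rightarrow> 'e \<Rightarrow> real) \<Rightarrow> 'e \<Rightarrow> 'e \<Rightarrow> 'e \<Rightarrow> 'e \<Rightarrow> real" where
  "d2 F x u v w =
     frechet_derivative (\<lambda>x. F x v w) (at x) u
   - frechet_derivative (\<lambda>x. F x u w) (at x) v
   + frechet_derivative (\<lambda>x. F x u v) (at x) w"

text \<open>Smooth real 2-forms on the manifold with parametrizations \<open>B\<close>.  The last clause sets \<open>F\<close>
  to 0 where it has no meaning, so that equal forms are equal functions.\<close>

definition two_form_on ::
  "('p, 'd::euclidean_space) patch set \<Rightarrow>
   (('p, 'd) patch \<Rightarrow> 'd \<Rightarrow> 'd \<Rightarrow> 'd \<Rightarrow> real) \<Rightarrow> bool" where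
  "two_form_on B F \<longleftrightarrow>
     (\<forall>b\<in>B. (\<forall>y\<in>fst b. (\<forall>u. linear (F b y u)) \<and> (\<forall>v. linear (\<lambda>u. F b y u v)) \<and>
                        (\<forall>u. F b y u u = 0)) \<and>
            (\<forall>u v. smooth_on (fst b) (\<lambda>y. F b y u v))) \<and>
     (\<forall>b\<in>B. \<forall>b'\<in>B. \<forall>y \<in> overlap b b'. \<forall>u v.
        F b y u v = F b' (change b b' y) (dchange b b' y u) (dchange b b' y v)) \<and>
     (\<forall>b y u v. b \<notin> B \<or> y \<notin> fst b \<longrightarrow> F b y u v = 0)"


section \<open>Generalized complex structures\<close>

text \<open>A generalized tangent vector \<open>Y + \<xi>\<close> in coordinates.\<close>

type_synonym 'e gtan = "'e \<times> ('e \<Rightarrow>\<^sub>L real)"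

definition pairing :: "'e::euclidean_space gtan \<Rightarrow> 'e gtan \<Rightarrow> real" where
  "pairing s t = (blinfun_apply (snd s) (fst t) + blinfun_apply (snd t) (fst s)) / 2"

text \<open>\<open>[Y + \<xi>, Z + \<eta>] = [Y, Z] + L\<^sub>Y \<eta> - \<iota>\<^sub>Z d\<xi> + \<iota>\<^sub>Y \<iota>\<^sub>Z H\<close> at the point \<open>x\<close>, for sections over an
  open subset of the model space; here \<open>(\<iota>\<^sub>Y \<iota>\<^sub>Z H) w = H (Z, Y, w)\<close>.\<close>

definition lie_bracket ::
  "('e::euclidean_space \<Rightarrow> 'e) \<Rightarrow> ('e \<Rightarrow> 'e) \<Rightarrow> 'e \<Rightarrow> 'e" where
  "lie_bracket Y Z x =
     frechet_derivative Z (at x) (Y x) - frechet_derivative Y (at x) (Z x)"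

definition lie_deriv ::
  "('e::euclidean_space \<Rightarrow> 'e) \<Rightarrow> ('e \<Rightarrow> 'e \<Rightarrow>\<^sub>L real) \<Rightarrow> 'e \<Rightarrow> 'e \<Rightarrow> real" where
  "lie_deriv Y \<eta> x w =
     blinfun_apply (frechet_derivative \<eta> (at x) (Y x)) w
   + blinfun_apply (\<eta> x) (frechet_derivative Y (at x) w)"

definition d1 :: "('e::euclidean_space \<Rightarrow> 'e \<Rightarrow>\<^sub>L real) \<Rightarrow> 'e \<Rightarrow> 'e \<Rightarrow> 'e \<Rightarrow> real" where
  "d1 \<xi> x u v =
     blinfun_apply (frechet_derivative \<xi> (at x) u) v
   - blinfun_apply (frechet_derivative \<xi> (at x) v) u"

definition courant_bracket ::
  "('e::euclidean_space \<Rightarrow> 'e \<Rightarrow> 'e \<Rightarrow> 'e \<Rightarrow> real) \<Rightarrow>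
   ('e \<Rightarrow> 'e gtan) \<Rightarrow> ('e \<Rightarrow> 'e gtan) \<Rightarrow> 'e \<Rightarrow> 'e gtan" where
  "courant_bracket H s t x =
     (let Y = (\<lambda>x. fst (s x)); \<xi> = (\<lambda>x. snd (s x));
          Z = (\<lambda>x. fst (t x)); \<eta> = (\<lambda>x. snd (t x))
      in (lie_bracket Y Z x,
          Blinfun (\<lambda>w. lie_deriv Y \<eta> x w - d1 \<xi> x (Z x) w + H x (Z x) (Y x) w)))"

text \<open>An element \<open>s + i s'\<close> of the complexification is the pair \<open>(s, s')\<close>.  The bracket is
  extended complex bilinearly.\<close>

definition courant_bracket_complex ::
  "('e::euclidean_space \<Rightarrow> 'e \<Rightarrow> 'e \<Rightarrow> 'e \<Rightarrow> real) \<Rightarrow>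
   ('e \<Rightarrow> 'e gtan \<times> 'e gtan) \<Rightarrow> ('e \<Rightarrow> 'e gtan \<times> 'e gtan) \<Rightarrow> 'e \<Rightarrow> 'e gtan \<times> 'e gtan" where
  "courant_bracket_complex H s t x =
     (let s1 = (\<lambda>x. fst (s x)); s2 = (\<lambda>x. snd (s x));
          t1 = (\<lambda>x. fst (t x)); t2 = (\<lambda>x. snd (t x))
      in (courant_bracket H s1 t1 x - courant_bracket H s2 t2 x,
          courant_bracket H s1 t2 x + courant_bracket H s2 t1 x))"

text \<open>\<open>J (s + i s') = i (s + i s')\<close>.\<close>

definition plus_i_eigenspace ::
  "('e::euclidean_space gtan \<Rightarrow>\<^sub>L 'e gtan) \<Rightarrow> ('e gtan \<times> 'e gtan) set" where
  "plus_i_eigenspace J = {(s, s'). blinfun_apply J s = - s' \<and> blinfun_apply J s' = s}"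

text \<open>\<open>Y + \<xi>\<close> in coordinates \<open>a\<close> at \<open>x\<close> and \<open>Y' + \<xi>'\<close> in coordinates \<open>b\<close> are the same
  generalized tangent vector: \<open>Y'\<close> is the push-forward of \<open>Y\<close>, and \<open>\<xi>\<close> the pull-back of \<open>\<xi>'\<close>.\<close>

definition gtan_corr ::
  "('p, 'e::euclidean_space) patch \<Rightarrow> ('p, 'e) patch \<Rightarrow> 'e \<Rightarrow> 'e gtan \<Rightarrow> 'e gtan \<Rightarrow> bool" where
  "gtan_corr a b x s t \<longleftrightarrow> fst t = dchange a b x (fst s) \<and>
     (\<forall>w. blinfun_apply (snd s) w = blinfun_apply (snd t) (dchange a b x w))"

text \<open>The twist \<open>H\<close> and the endomorphism \<open>J\<close> are families of local representatives.\<close>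

definition generalized_complex_structure ::
  "('p, 'e::euclidean_space) patch set \<Rightarrow>
   (('p, 'e) patch \<Rightarrow> 'e \<Rightarrow> 'e \<Rightarrow> 'e \<Rightarrow> 'e \<Rightarrow> real) \<Rightarrow>
   (('p, 'e) patch \<Rightarrow> 'e \<Rightarrow> 'e gtan \<Rightarrow>\<^sub>L 'e gtan) \<Rightarrow> bool" where
  "generalized_complex_structure M H J \<longleftrightarrow>
     (\<forall>a\<in>M. smooth_on (fst a) (J a)) \<and>
     (\<forall>a\<in>M. \<forall>b\<in>M. \<forall>x \<in> overlap a b. \<forall>s t. gtan_corr a b x s t \<longrightarrow>
        gtan_corr a b x (blinfun_apply (J a x) s) (blinfun_apply (J b (change a b x)) t)) \<and>
     (\<forall>a\<in>M. \<forall>x\<in>fst a.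
        (\<forall>s. blinfun_apply (J a x) (blinfun_apply (J a x) s) = - s) \<and>
        (\<forall>s t. pairing (blinfun_apply (J a x) s) (blinfun_apply (J a x) t) = pairing s t)) \<and>
     (\<forall>a\<in>M. \<forall>W s t. open W \<and> W \<subseteq> fst a \<and> smooth_on W s \<and> smooth_on W t \<and>
        (\<forall>x\<in>W. s x \<in> plus_i_eigenspace (J a x) \<and> t x \<in> plus_i_eigenspace (J a x)) \<longrightarrow>
        (\<forall>x\<in>W. courant_bracket_complex (H a) s t x \<in> plus_i_eigenspace (J a x)))"

text \<open>The fibre \<open>{Y + \<iota>\<^sub>Y C}\<close> of the graph of a complex 2-form, over all complex vectors
  \<open>Y = u + i v\<close>.\<close>

definition graph_form ::
  "('e::euclidean_space \<Rightarrow> 'e \<Rightarrow> complex) \<Rightarrow> ('e gtan \<times> 'e gtan) set" where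
  "graph_form C = {((u, \<alpha>), (v, \<beta>)) | u v \<alpha> \<beta>. \<forall>w.
     of_real (blinfun_apply \<alpha> w) + \<i> * of_real (blinfun_apply \<beta> w) = C u w + \<i> * C v w}"


section \<open>Branes\<close>

text \<open>Below, \<open>M\<close> parametrizes the ambient manifold, \<open>B\<close> the submanifold, and for \<open>b \<in> B\<close> and
  \<open>a \<in> M\<close> the inclusion \<open>\<iota>\<close> in coordinates is \<open>change b a\<close>.\<close>

definition courant_trivialization ::
  "('p, 'e::euclidean_space) patch set \<Rightarrow>
   (('p, 'e) patch \<Rightarrow> 'e \<Rightarrow> 'e \<Rightarrow> 'e \<Rightarrow> 'e \<Rightarrow> real) \<Rightarrow>
   ('p, 'd::euclidean_space) patch set \<Rightarrow>
   (('p, 'd) patch \<Rightarrow> 'd \<Rightarrow> 'd \<Rightarrow> 'd \<Rightarrow> real) \<Rightarrow> bool" where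
  "courant_trivialization M H B F \<longleftrightarrow> two_form_on B F \<and>
     (\<forall>b\<in>B. \<forall>a\<in>M. \<forall>y \<in> overlap b a. \<forall>u v w.
        d2 (F b) y u v w =
        H a (change b a y) (dchange b a y u) (dchange b a y v) (dchange b a y w))"

text \<open>\<open>Y \<in> TS\<close> and \<open>\<iota>\<^sup>* \<xi> = \<iota>\<^sub>Y F\<close>, in the coordinates \<open>a\<close>.\<close>

definition gen_tangent ::
  "(('p, 'd::euclidean_space) patch \<Rightarrow> 'd \<Rightarrow> 'd \<Rightarrow> 'd \<Rightarrow> real) \<Rightarrow>
   ('p, 'd) patch \<Rightarrow> ('p, 'e::euclidean_space) patch \<Rightarrow> 'd \<Rightarrow> 'e gtan set" where
  "gen_tangent F b a y = {(Y, \<xi>). \<exists>u. Y = dchange b a y u \<and>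
     (\<forall>v. blinfun_apply \<xi> (dchange b a y v) = F b y u v)}"

definition rank0_brane ::
  "('p, 'e::euclidean_space) patch set \<Rightarrow>
   (('p, 'e) patch \<Rightarrow> 'e \<Rightarrow> 'e \<Rightarrow> 'e \<Rightarrow> 'e \<Rightarrow> real) \<Rightarrow>
   (('p, 'e) patch \<Rightarrow> 'e \<Rightarrow> 'e gtan \<Rightarrow>\<^sub>L 'e gtan) \<Rightarrow>
   'p set \<Rightarrow> (('p, 'd::euclidean_space) patch \<Rightarrow> 'd \<Rightarrow> 'd \<Rightarrow> 'd \<Rightarrow> real) \<Rightarrow> bool" where
  "rank0_brane M H J S F \<longleftrightarrow>
     courant_trivialization M H (submanifold_patches M S) F \<and>
     (\<forall>b \<in> submanifold_patches M S. \<forall>a\<in>M. \<forall>y \<in> overlap b a.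
        blinfun_apply (J a (change b a y)) ` gen_tangent F b a y = gen_tangent F b a y)"


section \<open>The Hopf surface\<close>

text \<open>A point of \<open>X\<close> is an orbit of multiplication by powers of 2.  The parametrizations are
  the restrictions of the quotient map to open sets on which it is injective, so that local
  coordinates on \<open>X\<close> are always \<open>(x\<^sub>1, x\<^sub>2)\<close>, up to a power of 2.\<close>

type_synonym hopf_point = "(complex \<times> complex) set"

definition hopf_proj :: "complex \<times> complex \<Rightarrow> hopf_point" where
  "hopf_proj x = range (\<lambda>k::int. (2 powi k) *\<^sub>R x)"

definition hopf_surface :: "hopf_point set" where
  "hopf_surface = hopf_proj ` (UNIV - {0})"

definition hopf_atlas :: "(hopf_point, complex \<times> complex) patch set" where
  "hopf_atlas = {(V, hopf_proj) | V. open V \<and> 0 \<notin> V \<and> inj_on hopf_proj V}"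

lemma Ck_on_cong:
  assumes "open U" "\<And>x. x \<in> U \<Longrightarrow> f x = g x" "Ck_on k U f"
  shows "Ck_on k U g"
  using assms
proof (induction k arbitrary: f g)
  case 0
  then show ?case using continuous_on_cong[of U U f g] by simp
next
  case (Suc k)
  have ev: "(g has_derivative frechet_derivative f (at x)) (at x)" if "x \<in> U" for x
  proof -
    have "(f has_derivative frechet_derivative f (at x)) (at x)"
      using Suc.prems(3) that by (auto simp: frechet_derivative_works)
    then show ?thesis
      using has_derivative_transform_within_open[of f _ x UNIV U g] Suc.prems(1,2) that by auto
  qed
  have eq: "frechet_derivative f (at x) v = frechet_derivative g (at x) v" if "x \<in> U" for x v
    using frechet_derivative_at[OF ev[OF that]] by simp
  have "Ck_on k U (\<lambda>x. frechet_derivative g (at x) v)" for v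
    using Suc.IH[OF Suc.prems(1) eq[of _ v]] Suc.prems(3) by simp
  moreover have "g differentiable (at x)" if "x \<in> U" for x
    using ev[OF that] by (rule differentiableI)
  ultimately show ?case by simp
qed

lemma Ck_on_local:
  assumes "\<And>x. x \<in> U \<Longrightarrow> \<exists>W. open W \<and> x \<in> W \<and> W \<subseteq> U \<and> Ck_on k W f"
  shows "Ck_on k U f"
  using assms
proof (induction k arbitrary: f)
  case 0
  have "U = \<Union>{W. open W \<and> W \<subseteq> U \<and> continuous_on W f}"
    using 0 by auto
  moreover have "continuous_on (\<Union>{W. open W \<and> W \<subseteq> U \<and> continuous_on W f}) f"
    by (rule continuous_on_open_Union) auto
  ultimately show ?case by simp
next
  case (Suc k)
  show ?case
  proof (simp, intro conjI allI ballI)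
    fix x assume "x \<in> U"
    then show "f differentiable (at x)" using Suc.prems by fastforce
  next
    fix v
    show "Ck_on k U (\<lambda>x. frechet_derivative f (at x) v)"
      by (rule Suc.IH) (use Suc.prems in fastforce)
  qed
qed

lemma Ck_on_const: "Ck_on k U (\<lambda>_. c)"
  by (induction k arbitrary: c) auto

lemma Ck_on_scaleR: "Ck_on k U (\<lambda>x. r *\<^sub>R x)"
proof (cases k)
  case 0
  then show ?thesis by (auto intro: continuous_intros)
next
  case (Suc m)
  have d: "((\<lambda>x. r *\<^sub>R x) has_derivative (\<lambda>x. r *\<^sub>R x)) (at x)" for x :: 'a
    by (auto intro!: derivative_eq_intros)
  show ?thesis
    unfolding Suc using d frechet_derivative_at[OF d, symmetric]
    by (auto simp: differentiable_def Ck_on_const)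
qed

lemma hopf_proj_eq_iff: "hopf_proj x = hopf_proj y \<longleftrightarrow> (\<exists>k::int. y = (2 powi k) *\<^sub>R x)"
proof
  assume "hopf_proj x = hopf_proj y"
  moreover have "y \<in> hopf_proj y"
    unfolding hopf_proj_def by (rule range_eqI[of _ _ 0]) simp
  ultimately show "\<exists>k::int. y = (2 powi k) *\<^sub>R x"
    unfolding hopf_proj_def by blast
next
  assume "\<exists>k::int. y = (2 powi k) *\<^sub>R x"
  then obtain k :: int where k: "y = (2 powi k) *\<^sub>R x" by blast
  have "(2 powi j) *\<^sub>R y = (2 powi (j + k)) *\<^sub>R x"
       "(2 powi j) *\<^sub>R x = (2 powi (j - k)) *\<^sub>R y" for j :: int
    using k by (simp_all add: power_int_add power_int_diff)
  then show "hopf_proj x = hopf_proj y"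
    unfolding hopf_proj_def by blast
qed

lemma powi_2_near_1:
  assumes "(1/2::real) < 2 powi k" "(2::real) powi k < 2"
  shows "k = 0"
proof -
  have "k < 1" using assms(2) power_int_increasing[of 1 k "2::real"] by fastforce
  moreover have "- 1 < k" using assms(1) power_int_increasing[of k "-1" "2::real"] by fastforce
  ultimately show ?thesis by simp
qed

lemma hopf_change_local:
  assumes a: "a \<in> hopf_atlas" and b: "b \<in> hopf_atlas" and x: "x \<in> overlap a b"
  obtains W and k :: int where "open W" "x \<in> W" "W \<subseteq> overlap a b"
    "\<And>y. y \<in> W \<Longrightarrow> change a b y = (2 powi k) *\<^sub>R y"
proof -
  obtain V V' where V: "a = (V, hopf_proj)" "open V" "0 \<notin> V"
    and V': "b = (V', hopf_proj)" "open V'" "inj_on hopf_proj V'"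
    using a b unfolding hopf_atlas_def by auto
  obtain x' where x': "x' \<in> V'" "hopf_proj x = hopf_proj x'" and "x \<in> V"
    using x unfolding overlap_def V(1) V'(1) by auto
  obtain k :: int where k: "x' = (2 powi k) *\<^sub>R x"
    using x'(2) hopf_proj_eq_iff by blast
  define W where "W = V \<inter> (\<lambda>y. (2 powi k) *\<^sub>R y) -` V'"
  have proj: "hopf_proj ((2 powi k) *\<^sub>R y) = hopf_proj y" for y
    using hopf_proj_eq_iff by metis
  have "open W"
    unfolding W_def using V(2) V'(2)
    by (intro open_Int open_vimage continuous_intros) auto
  moreover have "x \<in> W" unfolding W_def using \<open>x \<in> V\<close> x'(1) k by auto
  moreover have "W \<subseteq> overlap a b"
  proof
    fix y assume "y \<in> W"
    then have "y \<in> V" "(2 powi k) *\<^sub>R y \<in> V'" unfolding W_def by auto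
    moreover from this(2) have "hopf_proj ((2 powi k) *\<^sub>R y) \<in> hopf_proj ` V'" by (rule imageI)
    ultimately show "y \<in> overlap a b"
      unfolding overlap_def V(1) V'(1) proj by simp
  qed
  moreover have "change a b y = (2 powi k) *\<^sub>R y" if "y \<in> W" for y
  proof -
    have "inv_into V' hopf_proj (hopf_proj ((2 powi k) *\<^sub>R y)) = (2 powi k) *\<^sub>R y"
      using that V'(3) unfolding W_def by (intro inv_into_f_f) auto
    then show ?thesis unfolding change_def V'(1) V(1) by (simp add: proj)
  qed
  ultimately show ?thesis using that by blast
qed

lemma smooth_atlas_hopf: "smooth_atlas hopf_atlas hopf_surface"
  unfolding smooth_atlas_def
proof (intro conjI ballI)
  fix a assume "a \<in> hopf_atlas"
  then show "open (fst a)" "inj_on (snd a) (fst a)" unfolding hopf_atlas_def by auto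
next
  have "hopf_proj x \<in> (\<Union>a\<in>hopf_atlas. snd a ` fst a)" if "x \<noteq> 0" for x
  proof -
    define V where "V = ball x (norm x / 3)"
    have bd: "2/3 * norm x < norm y" "norm y < 4/3 * norm x" if "y \<in> V" for y
      using that norm_triangle_ineq2[of x y] norm_triangle_ineq2[of y x]
      unfolding V_def by (auto simp: dist_norm norm_minus_commute)
    have "inj_on hopf_proj V"
    proof (rule inj_onI)
      fix y z assume y: "y \<in> V" and z: "z \<in> V" and "hopf_proj y = hopf_proj z"
      then obtain k :: int where k: "z = (2 powi k) *\<^sub>R y" using hopf_proj_eq_iff by blast
      then have n: "norm z = 2 powi k * norm y" by (simp add: power_int_abs)
      have "norm z < 2 * norm y" "norm y < 2 * norm z"
        using bd[OF y] bd[OF z] by linarith+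
      moreover have "0 < norm y" using bd(1)[OF y] norm_ge_zero[of x] by linarith
      ultimately have "2 powi k < (2::real)" "(1/2::real) < 2 powi k"
        unfolding n using mult_less_cancel_right_pos[of "norm y" "1/2" "2 powi k"]
        by auto
      then have "k = 0" using powi_2_near_1 by blast
      then show "y = z" using k by simp
    qed
    moreover have "open V" "0 \<notin> V" "x \<in> V"
      using \<open>x \<noteq> 0\<close> unfolding V_def by (auto simp: dist_norm)
    ultimately have "(V, hopf_proj) \<in> hopf_atlas" unfolding hopf_atlas_def by auto
    then show ?thesis using \<open>x \<in> V\<close> by force
  qed
  moreover have "snd a ` fst a \<subseteq> hopf_surface" if "a \<in> hopf_atlas" for a
    using that unfolding hopf_atlas_def hopf_surface_def by auto
  ultimately show "(\<Union>a\<in>hopf_atlas. snd a ` fst a) = hopf_surface"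
    unfolding hopf_surface_def by blast
next
  fix a b assume ab: "a \<in> hopf_atlas" "b \<in> hopf_atlas"
  show "open (overlap a b)"
    unfolding open_subopen[of "overlap a b"] using hopf_change_local[OF ab] by metis
  show "smooth_on (overlap a b) (change a b)"
    unfolding smooth_on_def
  proof (intro allI Ck_on_local)
    fix n x assume "x \<in> overlap a b"
    then obtain W and k :: int where W: "open W" "x \<in> W" "W \<subseteq> overlap a b"
      "\<And>y. y \<in> W \<Longrightarrow> change a b y = (2 powi k) *\<^sub>R y"
      using hopf_change_local[OF ab] by metis
    then have "Ck_on n W (change a b)"
      using Ck_on_cong[OF W(1) _ Ck_on_scaleR] by metis
    then show "\<exists>W. open W \<and> x \<in> W \<and> W \<subseteq> overlap a b \<and> Ck_on n W (change a b)"
      using W by blast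
  qed
qed

definition wedge11 :: "('e \<Rightarrow> complex) \<Rightarrow> ('e \<Rightarrow> complex) \<Rightarrow> 'e \<Rightarrow> 'e \<Rightarrow> complex" where
  "wedge11 \<alpha> \<beta> u v = \<alpha> u * \<beta> v - \<alpha> v * \<beta> u"

definition wedge12 ::
  "('e \<Rightarrow> complex) \<Rightarrow> ('e \<Rightarrow> 'e \<Rightarrow> complex) \<Rightarrow> 'e \<Rightarrow> 'e \<Rightarrow> 'e \<Rightarrow> complex" where
  "wedge12 \<alpha> \<omega> u v w = \<alpha> u * \<omega> v w - \<alpha> v * \<omega> u w + \<alpha> w * \<omega> u v"

abbreviation (input) dx1 :: "complex \<times> complex \<Rightarrow> complex" where "dx1 u \<equiv> fst u"
abbreviation (input) dx1bar :: "complex \<times> complex \<Rightarrow> complex" where "dx1bar u \<equiv> cnj (fst u)"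
abbreviation (input) dx2 :: "complex \<times> complex \<Rightarrow> complex" where "dx2 u \<equiv> snd u"
abbreviation (input) dx2bar :: "complex \<times> complex \<Rightarrow> complex" where "dx2bar u \<equiv> cnj (snd u)"

definition hopf_R2 :: "complex \<times> complex \<Rightarrow> complex" where
  "hopf_R2 x = fst x * cnj (fst x) + snd x * cnj (snd x)"

definition hopf_C ::
  "complex \<times> complex \<Rightarrow> complex \<times> complex \<Rightarrow> complex \<times> complex \<Rightarrow> complex" where
  "hopf_C x u v = 1 / hopf_R2 x *
     (2 * fst x / cnj (snd x) * wedge11 dx1bar dx2bar u v
      + wedge11 dx1 dx1bar u v + wedge11 dx2 dx2bar u v)"

definition hopf_H_complex ::
  "complex \<times> complex \<Rightarrow> complex \<times> complex \<Rightarrow> complex \<times> complex \<Rightarrow> complex \<times> complex \<Rightarrow> complex"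
  where
  "hopf_H_complex x u v w = 1 / (hopf_R2 x)\<^sup>2 *
     (wedge12 (\<lambda>z. snd x * dx2bar z - cnj (snd x) * dx2 z) (wedge11 dx1 dx1bar) u v w
      + wedge12 (\<lambda>z. fst x * dx1bar z - cnj (fst x) * dx1 z) (wedge11 dx2 dx2bar) u v w)"

text \<open>The form is real, so nothing is lost in taking the real part.\<close>

definition hopf_H ::
  "complex \<times> complex \<Rightarrow> complex \<times> complex \<Rightarrow> complex \<times> complex \<Rightarrow> complex \<times> complex \<Rightarrow> real"
  where
  "hopf_H x u v w = Re (hopf_H_complex x u v w)"

lemma of_real_hopf_H: "complex_of_real (hopf_H x u v w) = hopf_H_complex x u v w"
proof -
  have "cnj (hopf_H_complex x u v w) = hopf_H_complex x u v w"
    unfolding hopf_H_complex_def hopf_R2_def wedge11_def wedge12_def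
    by (simp add: algebra_simps)
  then show ?thesis
    unfolding hopf_H_def by (simp add: complex_eq_iff)
qed

definition hopf_sphere :: "real \<Rightarrow> hopf_point set" where
  "hopf_sphere c = hopf_proj ` {x. fst x \<in> \<real> \<and> hopf_R2 x = of_real c}"

end

theory Submission
  imports Defs
begin

text \<open>
  The brane is the zero form. On the sphere \<open>x\<^sub>1\<close> is real and \<open>x\<^sub>1\<^sup>2 + x\<^sub>2 x\<^sub>2bar\<close> is constant, so that
  \<open>2 x\<^sub>1 dx\<^sub>1 = - x\<^sub>2 dx\<^sub>2bar - x\<^sub>2bar dx\<^sub>2\<close>; inserting this, the first term of \<open>C\<close> cancels the third,
  the second vanishes, and \<open>C\<close> restricts to zero on \<open>S\<close> wherever \<open>x\<^sub>2 \<noteq> 0\<close>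
  (\<open>hopf_C_zero_on_sphere_tangent\<close>). Since \<open>Im C\<close> is nondegenerate and \<open>S\<close> has half the dimension
  of \<open>X\<close>, each \<open>T\<^sub>xS\<close> is its own orthogonal complement for \<open>Im C\<close>
  (\<open>sphere_tangent_lagrangian\<close>).

  For a real \<open>s = Y + \<xi>\<close> the vector \<open>s - i J s\<close> lies in the graph of \<open>C\<close>. Thus, with
  \<open>J s = Y' + \<xi>'\<close>, one has \<open>\<xi> - i \<xi>' = C(Y - i Y', -)\<close>. Both halves of the theorem
  come from restricting this relation to \<open>T\<^sub>xS\<close>. If \<open>Y\<close> is tangent to \<open>S\<close> and \<open>\<xi>\<close> kills \<open>T\<^sub>xS\<close>,
  it says that \<open>C(Y', w) = \<xi>'(w)\<close> is real for tangent \<open>w\<close>; hence \<open>Y'\<close> is tangent, and then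
  \<open>\<xi>'\<close> kills \<open>T\<^sub>xS\<close>. So \<open>J\<close> preserves \<open>TS \<oplus> N\<^sup>*S\<close>, the generalized tangent bundle of \<open>F = 0\<close>.
  Conversely, if \<open>F\<close> is any brane and \<open>\<xi>\<close> restricts to \<open>\<iota>\<^sub>Y F\<close>, then \<open>Y\<close> and \<open>Y'\<close> are both tangent,
  the right hand side vanishes on \<open>T\<^sub>xS\<close>, and so does \<open>\<xi>\<close>; that is, \<open>F = 0\<close>.

  The points with \<open>x\<^sub>2 = 0\<close> are reached by continuity: of \<open>J\<close> along a path \<open>(x\<^sub>1, e)\<close>, \<open>e \<rightarrow> 0\<close>,
  for existence (\<open>conormal_sum_invariant\<close>), and of \<open>F\<close> for uniqueness, as the points of \<open>S\<close> with
  \<open>x\<^sub>2 \<noteq> 0\<close> are dense (\<open>sphere_patch_generic_dense\<close>). The condition \<open>dF = \<iota>\<^sup>* H\<close> for \<open>F = 0\<close> holds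
  because a 3-form vanishes on a surface.
\<close>

section \<open>Tangent planes of the spheres\<close>

text \<open>The radius does not enter, so this is the tangent plane at \<open>x\<close> of the sphere of real \<open>x\<^sub>1\<close>
  that passes through \<open>x\<close>, whichever power of 2 the coordinates have been scaled by.\<close>

definition sphere_tangent :: "complex \<times> complex \<Rightarrow> (complex \<times> complex) set" where
  "sphere_tangent x = {w. Im (fst w) = 0 \<and> w \<bullet> x = 0}"

text \<open>The fibre of \<open>TS \<oplus> N\<^sup>*S\<close>.\<close>

definition conormal_sum :: "complex \<times> complex \<Rightarrow> (complex \<times> complex) gtan set" where
  "conormal_sum x = {s. fst s \<in> sphere_tangent x \<and>
     (\<forall>w\<in>sphere_tangent x. blinfun_apply (snd s) w = 0)}"

lemma inner_i_first: "w \<bullet> (\<i>, 0 :: complex) = Im (fst w)"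
  by (simp add: inner_prod_def inner_complex_def)

lemma sphere_tangentE:
  assumes "w \<in> sphere_tangent (of_real r, z)"
  obtains q b where "w = (of_real q, b)" "q * r + b \<bullet> z = 0"
proof (rule that)
  show "w = (of_real (Re (fst w)), snd w)" "Re (fst w) * r + snd w \<bullet> z = 0"
    using assms unfolding sphere_tangent_def
    by (auto simp: prod_eq_iff complex_eq_iff inner_prod_def inner_complex_def)
qed

lemma real_first_coordinateE:
  assumes "Im (fst x) = 0"
  obtains r z where "x = (of_real r, z)"
  using assms by (metis complex_is_Real_iff Reals_cases prod.collapse)

lemma hopf_R2_eq_norm: "hopf_R2 x = of_real ((norm x)\<^sup>2)"
  unfolding hopf_R2_def norm_prod_def complex_norm_square [symmetric]
  by (simp add: complex_norm_square)

section \<open>The sphere is Lagrangian where the second coordinate is nonzero\<close>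

text \<open>The tangency conditions express \<open>2 x\<^sub>1 dx\<^sub>1\<close> through \<open>dx\<^sub>2\<close> and \<open>dx\<^sub>2bar\<close>, and this cancels
  the \<open>dx\<^sub>2 \<and> dx\<^sub>2bar\<close> term.\<close>

lemma hopf_C_zero_on_sphere_tangent:
  assumes x: "Im (fst x) = 0" "snd x \<noteq> 0"
    and Y: "Y \<in> sphere_tangent x" and w: "w \<in> sphere_tangent x"
  shows "hopf_C x Y w = 0"
proof -
  obtain r z where xe: "x = (of_real r, z)"
    using x(1) by (rule real_first_coordinateE)
  have z: "z \<noteq> 0" using x(2) xe by simp
  obtain p a where Ye: "Y = (of_real p, a)" and Yx: "p * r + a \<bullet> z = 0"
    using Y unfolding xe by (rule sphere_tangentE)
  obtain q b where we: "w = (of_real q, b)" and wx: "q * r + b \<bullet> z = 0"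
    using w unfolding xe by (rule sphere_tangentE)
  have re: "complex_of_real (2 * (u \<bullet> z)) = u * cnj z + z * cnj u" for u
    by (simp add: complex_eq_iff inner_complex_def)
  have p: "2 * of_real p * of_real r = - (a * cnj z + z * cnj a)"
    using arg_cong[OF Yx, of "\<lambda>t. complex_of_real (2 * t)"] re[of a]
    by (simp add: algebra_simps eq_neg_iff_add_eq_0)
  have q: "2 * of_real q * of_real r = - (b * cnj z + z * cnj b)"
    using arg_cong[OF wx, of "\<lambda>t. complex_of_real (2 * t)"] re[of b]
    by (simp add: algebra_simps eq_neg_iff_add_eq_0)
  have "2 * of_real r * (of_real p * cnj b - of_real q * cnj a)
        + cnj z * (a * cnj b - b * cnj a) = 0"
    using p q by algebra
  then have "2 * of_real r / cnj z * (of_real p * cnj b - of_real q * cnj a)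
        + (a * cnj b - b * cnj a) = 0"
    using z by (simp add: field_simps)
  then show ?thesis
    unfolding hopf_C_def wedge11_def xe Ye we by simp
qed

text \<open>The maximality half of being Lagrangian: pairing \<open>v\<close> with two tangent vectors that span the
  plane gives exactly the two equations for \<open>v\<close> to be tangent.\<close>

lemma sphere_tangent_lagrangian:
  assumes x: "Im (fst x) = 0" "snd x \<noteq> 0"
    and v: "\<And>w. w \<in> sphere_tangent x \<Longrightarrow> Im (hopf_C x v w) = 0"
  shows "v \<in> sphere_tangent x"
proof -
  obtain r z where xe: "x = (of_real r, z)"
    using x(1) by (rule real_first_coordinateE)
  have z: "z \<noteq> 0" using x(2) xe by simp
  obtain v1 v2 where ve: "v = (v1, v2)" by (cases v)
  define N where "N = (norm x)\<^sup>2"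
  have N: "N = r\<^sup>2 + (cmod z)\<^sup>2" "N > 0"
    unfolding N_def xe norm_prod_def using z by (auto simp: sum_power2_gt_zero_iff)
  \<comment> \<open>Rotation of \<open>x\<^sub>2\<close> (the field \<open>\<partial>/\<partial>\<phi>\<close> for \<open>x\<^sub>2 = \<rho> e\<^sup>i\<^sup>\<phi>\<close>), and \<open>\<rho>\<close> times the rotation
    of the \<open>(x\<^sub>1, \<rho>)\<close> half-plane.\<close>
  define k1 k2 where "k1 = (0::complex, \<i> * z)"
    and "k2 = (- complex_of_real ((cmod z)\<^sup>2), of_real r * z)"
  have k1: "k1 \<in> sphere_tangent x"
    unfolding sphere_tangent_def k1_def xe by (simp add: inner_complex_def)
  have k2: "k2 \<in> sphere_tangent x"
    unfolding sphere_tangent_def k2_def xe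
    by (simp add: inner_complex_def cmod_power2) (simp add: algebra_simps power2_eq_square)
  have R2: "hopf_R2 x = of_real N" unfolding N_def by (rule hopf_R2_eq_norm)
  have C: "hopf_C x v w * of_real N = 
      2 * of_real r / cnj z * (cnj v1 * cnj (snd w) - cnj (fst w) * cnj v2)
      + (v1 * cnj (fst w) - fst w * cnj v1) + (v2 * cnj (snd w) - snd w * cnj v2)" for w
    using N(2) unfolding hopf_C_def R2 wedge11_def ve by (simp add: xe)
  have zz: "complex_of_real ((cmod z)\<^sup>2) = z * cnj z" by (rule complex_norm_square)
  have "hopf_C x v k1 * of_real N = - 2 * \<i> * of_real r * cnj v1 - 2 * \<i> * of_real (v2 \<bullet> z)"
    unfolding C k1_def using z by (auto simp: complex_eq_iff inner_complex_def algebra_simps)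
  from arg_cong[OF this, of Im] have "r * Re v1 + v2 \<bullet> z = 0"
    using v[OF k1] by simp
  moreover have "hopf_C x v k2 * of_real N
      = 2 * (of_real r)\<^sup>2 * cnj v1 + 2 * of_real r * (z * cnj v2)
        - (z * cnj z) * (v1 - cnj v1) + of_real r * (v2 * cnj z - z * cnj v2)"
    unfolding C k2_def fst_conv snd_conv zz using z
    by (simp add: field_simps power2_eq_square)
  from arg_cong[OF this, of Im] have "- 2 * N * Im v1 = 0"
    using v[OF k2] unfolding N(1) cmod_power2
    by (simp add: algebra_simps power2_eq_square)
  ultimately show ?thesis
    unfolding sphere_tangent_def ve xe using N(2) by (simp add: inner_complex_def algebra_simps)
qed

section \<open>Invariance of the tangent-conormal sum\<close>

lemma generalized_complex_structure_square:
  assumes "generalized_complex_structure M H J" "a \<in> M" "x \<in> fst a"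
  shows "blinfun_apply (J a x) (blinfun_apply (J a x) s) = - s"
  using assms unfolding generalized_complex_structure_def by blast

lemma generalized_complex_structure_continuous:
  assumes "generalized_complex_structure M H J" "a \<in> M"
  shows "continuous_on (fst a) (J a)"
proof -
  have "smooth_on (fst a) (J a)"
    using assms(1)[unfolded generalized_complex_structure_def, THEN conjunct1] assms(2)
    by (rule bspec)
  then have "Ck_on 0 (fst a) (J a)" unfolding smooth_on_def by (rule spec)
  then show ?thesis by simp
qed

lemma graph_formD:
  assumes "(s, t) \<in> graph_form C"
  shows "of_real (blinfun_apply (snd s) w) + \<i> * of_real (blinfun_apply (snd t) w)
       = C (fst s) w + \<i> * C (fst t) w"
  using assms unfolding graph_form_def by auto

text \<open>As \<open>s - i J s\<close> is a \<open>+i\<close>-eigenvector, it lies in the graph of \<open>C\<close>. The relation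
  characterises \<open>J s\<close> implicitly; solving it for \<open>J\<close> would require the inverse of \<open>Im C\<close>.\<close>

lemma graph_form_relation:
  assumes J2: "\<And>s. blinfun_apply J (blinfun_apply J s) = - s"
    and L: "plus_i_eigenspace J = graph_form (hopf_C x)"
  shows "of_real (blinfun_apply (snd s) w) - \<i> * of_real (blinfun_apply (snd (blinfun_apply J s)) w)
       = hopf_C x (fst s) w - \<i> * hopf_C x (fst (blinfun_apply J s)) w"
proof -
  have "(s, - blinfun_apply J s) \<in> graph_form (hopf_C x)"
    unfolding L[symmetric] plus_i_eigenspace_def by (simp add: J2 blinfun.minus_right)
  then have "of_real (blinfun_apply (snd s) w)
        + \<i> * of_real (blinfun_apply (snd (- blinfun_apply J s)) w)
       = hopf_C x (fst s) w + \<i> * hopf_C x (fst (- blinfun_apply J s)) w"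
    by (rule graph_formD)
  moreover have "hopf_C x (- u) w = - hopf_C x u w" for u
    unfolding hopf_C_def wedge11_def by (simp add: algebra_simps)
  ultimately show ?thesis by (simp add: blinfun.minus_left)
qed

text \<open>The imaginary part of the relation puts the vector part of \<open>J s\<close> in the Lagrangian plane;
  once it is there, the vanishing of \<open>C\<close> on the plane kills the covector part.\<close>

lemma conormal_sum_invariant_generic:
  assumes J2: "\<And>s. blinfun_apply J (blinfun_apply J s) = - s"
    and L: "plus_i_eigenspace J = graph_form (hopf_C x)"
    and x: "Im (fst x) = 0" "snd x \<noteq> 0" and s: "s \<in> conormal_sum x"
  shows "blinfun_apply J s \<in> conormal_sum x"
proof -
  note rel = graph_form_relation[OF J2 L, of s]
  have s': "fst s \<in> sphere_tangent x"
    "\<And>w. w \<in> sphere_tangent x \<Longrightarrow> blinfun_apply (snd s) w = 0"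
    using s unfolding conormal_sum_def by auto
  have eq: "of_real (blinfun_apply (snd (blinfun_apply J s)) w)
      = hopf_C x (fst (blinfun_apply J s)) w" if "w \<in> sphere_tangent x" for w
    using rel[of w] hopf_C_zero_on_sphere_tangent[OF x s'(1) that] s'(2)[OF that] by simp
  have Y: "fst (blinfun_apply J s) \<in> sphere_tangent x"
    by (rule sphere_tangent_lagrangian[OF x]) (metis eq Im_complex_of_real)
  moreover have "blinfun_apply (snd (blinfun_apply J s)) w = 0" if "w \<in> sphere_tangent x" for w
    using eq[OF that] hopf_C_zero_on_sphere_tangent[OF x Y that] by simp
  ultimately show ?thesis
    unfolding conormal_sum_def by simp
qed

text \<open>Orthogonal projections to the tangent plane (on vectors with real first component) and to
  its conormal space. They depend continuously on \<open>x \<noteq> 0\<close> and so extend an element of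
  \<open>TS \<oplus> N\<^sup>*S\<close> at a point to a continuous family at nearby points.\<close>

definition tangent_part :: "complex \<times> complex \<Rightarrow> complex \<times> complex \<Rightarrow> complex \<times> complex" where
  "tangent_part x w = w - (w \<bullet> x / (x \<bullet> x)) *\<^sub>R x"

lemma tangent_part_in:
  assumes "Im (fst x) = 0" "x \<noteq> 0" "Im (fst w) = 0"
  shows "tangent_part x w \<in> sphere_tangent x"
  using assms unfolding sphere_tangent_def tangent_part_def
  by (simp add: inner_diff_left)

lemma tangent_part_id: "w \<in> sphere_tangent x \<Longrightarrow> tangent_part x w = w"
  unfolding sphere_tangent_def tangent_part_def by simp

definition conormal_part ::
  "complex \<times> complex \<Rightarrow> ((complex \<times> complex) \<Rightarrow>\<^sub>L real) \<Rightarrow> (complex \<times> complex) \<Rightarrow>\<^sub>L real" where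
  "conormal_part x \<xi> = blinfun_apply \<xi> (\<i>, 0) *\<^sub>R blinfun_inner_left (\<i>, 0)
     + (blinfun_apply \<xi> x / (x \<bullet> x)) *\<^sub>R blinfun_inner_left x"

lemma conormal_part_annihilates:
  "w \<in> sphere_tangent x \<Longrightarrow> blinfun_apply (conormal_part x \<xi>) w = 0"
  unfolding sphere_tangent_def conormal_part_def
  by (simp add: blinfun.add_left blinfun.scaleR_left inner_i_first)

lemma conormal_part_id:
  assumes x: "Im (fst x) = 0" "x \<noteq> 0"
    and \<xi>: "\<And>w. w \<in> sphere_tangent x \<Longrightarrow> blinfun_apply \<xi> w = 0"
  shows "conormal_part x \<xi> = \<xi>"
proof (rule blinfun_eqI)
  fix w :: "complex \<times> complex"
  define w' where "w' = w - Im (fst w) *\<^sub>R (\<i>, 0)"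
  have "Im (fst w') = 0" unfolding w'_def by simp
  then have "blinfun_apply \<xi> (tangent_part x w') = 0"
    by (intro \<xi> tangent_part_in x)
  moreover have "w' \<bullet> x = w \<bullet> x"
    using x(1) unfolding w'_def by (simp add: inner_diff_left inner_prod_def inner_complex_def)
  ultimately show "blinfun_apply (conormal_part x \<xi>) w = blinfun_apply \<xi> w"
    unfolding tangent_part_def conormal_part_def
    by (simp add: w'_def blinfun.diff_right blinfun.add_left blinfun.scaleR_left
        blinfun.scaleR_right inner_i_first mult.commute del: scaleR_Pair)
qed

text \<open>Only a point with \<open>x\<^sub>2 = 0\<close> needs an argument. Each \<open>(x\<^sub>1, e)\<close> lies on a sphere of its own, of
  a slightly different radius, and there the invariance is known; it passes to the limit because
  \<open>conormal_sum\<close> is cut out by equations that are continuous along the path.\<close>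

lemma conormal_sum_invariant:
  fixes J :: "complex \<times> complex \<Rightarrow> (complex \<times> complex) gtan \<Rightarrow>\<^sub>L (complex \<times> complex) gtan"
  assumes V: "open V" "0 \<notin> V" and cont: "continuous_on V J"
    and J2: "\<And>x s. x \<in> V \<Longrightarrow> blinfun_apply (J x) (blinfun_apply (J x) s) = - s"
    and L: "\<And>x. x \<in> V \<Longrightarrow> snd x \<noteq> 0 \<Longrightarrow> plus_i_eigenspace (J x) = graph_form (hopf_C x)"
    and x: "x \<in> V" "Im (fst x) = 0" and s: "s \<in> conormal_sum x"
  shows "blinfun_apply (J x) s \<in> conormal_sum x"
proof (cases "snd x = 0")
  case False
  then show ?thesis
    using conormal_sum_invariant_generic J2 L x s by blast
next
  case True
  have x0: "x \<noteq> 0" using x V by auto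
  obtain Y \<xi> where se: "s = (Y, \<xi>)" and Y: "Y \<in> sphere_tangent x"
    and \<xi>: "\<And>w. w \<in> sphere_tangent x \<Longrightarrow> blinfun_apply \<xi> w = 0"
    using s that[of "fst s" "snd s"] unfolding conormal_sum_def by simp
  define \<gamma> where "\<gamma> e = (fst x, complex_of_real e)" for e
  define \<sigma> where "\<sigma> e = (tangent_part (\<gamma> e) Y, conormal_part (\<gamma> e) \<xi>)" for e
  define j where "j e = blinfun_apply (J (\<gamma> e)) (\<sigma> e)" for e
  have \<gamma>: "(\<gamma> \<longlongrightarrow> x) (at 0)"
  proof -
    have "(\<gamma> \<longlongrightarrow> (fst x, of_real 0)) (at 0)"
      unfolding \<gamma>_def by (intro tendsto_intros)
    then show ?thesis using True by (metis of_real_0 prod.collapse)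
  qed
  have part: "((\<lambda>e. tangent_part (\<gamma> e) w) \<longlongrightarrow> w) (at 0)" if "w \<in> sphere_tangent x" for w
  proof -
    have "((\<lambda>e. tangent_part (\<gamma> e) w) \<longlongrightarrow> tangent_part x w) (at 0)"
      unfolding tangent_part_def using x0 by (intro tendsto_intros \<gamma>) auto
    then show ?thesis using tangent_part_id[OF that] by simp
  qed
  have "((\<lambda>e. conormal_part (\<gamma> e) \<xi>) \<longlongrightarrow> conormal_part x \<xi>) (at 0)"
    unfolding conormal_part_def using x0
    by (intro tendsto_intros \<gamma> bounded_linear.tendsto[OF bounded_linear_blinfun_inner_left]) auto
  also have "conormal_part x \<xi> = \<xi>"
    using x(2) x0 \<xi> by (rule conormal_part_id)
  finally have \<sigma>: "(\<sigma> \<longlongrightarrow> s) (at 0)"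
    unfolding \<sigma>_def se by (intro tendsto_Pair part Y)
  have "isCont J x" using cont V(1) x(1) by (simp add: continuous_on_eq_continuous_at)
  then have "((\<lambda>e. J (\<gamma> e)) \<longlongrightarrow> J x) (at 0)"
    using \<gamma> by (rule isCont_tendsto_compose)
  then have j: "(j \<longlongrightarrow> blinfun_apply (J x) s) (at 0)"
    unfolding j_def by (intro tendsto_intros \<sigma>)
  have "eventually (\<lambda>e. \<gamma> e \<in> V) (at 0)"
    using topological_tendstoD[OF \<gamma> V(1) x(1)] .
  moreover have "eventually (\<lambda>e::real. e \<noteq> 0) (at 0)"
    by (simp add: eventually_at_filter)
  ultimately have inv: "eventually (\<lambda>e. Im (fst (\<gamma> e)) = 0 \<and> \<gamma> e \<noteq> 0 \<and> j e \<in> conormal_sum (\<gamma> e)) (at 0)"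
  proof eventually_elim
    case (elim e)
    have g: "Im (fst (\<gamma> e)) = 0" "snd (\<gamma> e) \<noteq> 0" "\<gamma> e \<noteq> 0"
      unfolding \<gamma>_def using elim(2) x(2) by (auto simp: zero_prod_def)
    have "Im (fst Y) = 0" using Y unfolding sphere_tangent_def by simp
    then have "\<sigma> e \<in> conormal_sum (\<gamma> e)"
      unfolding \<sigma>_def conormal_sum_def using g
      by (auto intro: tangent_part_in conormal_part_annihilates)
    then show ?case
      unfolding j_def using conormal_sum_invariant_generic J2 L elim(1) g by blast
  qed
  have lim0: "l = 0" if "(h \<longlongrightarrow> l) (at 0)" "\<And>e. Im (fst (\<gamma> e)) = 0 \<Longrightarrow> \<gamma> e \<noteq> 0 \<Longrightarrow>
      j e \<in> conormal_sum (\<gamma> e) \<Longrightarrow> h e = 0" for h :: "real \<Rightarrow> real" and l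
  proof -
    have "eventually (\<lambda>e. h e = 0) (at 0)"
      using inv by eventually_elim (use that(2) in blast)
    then have "(h \<longlongrightarrow> 0) (at 0)" by (rule tendsto_eventually)
    then show ?thesis using that(1) tendsto_unique trivial_limit_at by blast
  qed
  have "Im (fst (fst (blinfun_apply (J x) s))) = 0"
    by (rule lim0[of "\<lambda>e. Im (fst (fst (j e)))"], intro tendsto_intros j)
       (auto simp: conormal_sum_def sphere_tangent_def)
  moreover have "fst (blinfun_apply (J x) s) \<bullet> x = 0"
    by (rule lim0[of "\<lambda>e. fst (j e) \<bullet> \<gamma> e"], intro tendsto_intros j \<gamma>)
       (auto simp: conormal_sum_def sphere_tangent_def)
  moreover have "blinfun_apply (snd (blinfun_apply (J x) s)) w = 0"
    if "w \<in> sphere_tangent x" for w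
  proof (rule lim0[of "\<lambda>e. blinfun_apply (snd (j e)) (tangent_part (\<gamma> e) w)"])
    show "((\<lambda>e. blinfun_apply (snd (j e)) (tangent_part (\<gamma> e) w))
      \<longlongrightarrow> blinfun_apply (snd (blinfun_apply (J x) s)) w) (at 0)"
      by (intro tendsto_intros j part that)
    show "blinfun_apply (snd (j e)) (tangent_part (\<gamma> e) w) = 0"
      if g: "Im (fst (\<gamma> e)) = 0" "\<gamma> e \<noteq> 0" "j e \<in> conormal_sum (\<gamma> e)" for e
    proof -
      have "Im (fst w) = 0" using \<open>w \<in> sphere_tangent x\<close> unfolding sphere_tangent_def by simp
      then have "tangent_part (\<gamma> e) w \<in> sphere_tangent (\<gamma> e)" by (rule tangent_part_in[OF g(1,2)])
      then show ?thesis using g(3) unfolding conormal_sum_def by blast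
    qed
  qed
  ultimately show ?thesis
    unfolding conormal_sum_def sphere_tangent_def by auto
qed

section \<open>Parametrizations of the sphere\<close>

lemma hopf_sphere_lift:
  assumes "hopf_proj x \<in> hopf_sphere c" "c > 0"
  shows "Im (fst x) = 0" "\<exists>k::int. norm x = 2 powi k * sqrt c"
proof -
  obtain y where y: "fst y \<in> \<real>" "hopf_R2 y = of_real c" "hopf_proj y = hopf_proj x"
    using assms(1) unfolding hopf_sphere_def by auto
  obtain k :: int where k: "x = (2 powi k) *\<^sub>R y"
    using y(3) hopf_proj_eq_iff by blast
  have "(norm y)\<^sup>2 = c" using y(2) unfolding hopf_R2_eq_norm by (simp only: of_real_eq_iff)
  then have "norm y = sqrt c" using real_sqrt_unique[of "norm y" c] by simp
  then have "norm x = 2 powi k * sqrt c" unfolding k by (simp add: power_int_abs)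
  then show "\<exists>k::int. norm x = 2 powi k * sqrt c" ..
  show "Im (fst x) = 0" using y(1) unfolding k by (simp add: complex_is_Real_iff)
qed

text \<open>The plane is the orthogonal complement in \<open>\<real>\<^sup>4\<close> of the independent vectors \<open>(i, 0)\<close>
  and \<open>x\<close>.\<close>

lemma dim_sphere_tangent:
  assumes "Im (fst x) = 0" "x \<noteq> 0"
  shows "subspace (sphere_tangent x)" "dim (sphere_tangent x) = 2"
proof -
  define n :: "complex \<times> complex" where "n = (\<i>, 0)"
  have n: "y \<bullet> n = Im (fst y)" for y unfolding n_def by (rule inner_i_first)
  have n0: "n \<noteq> 0" unfolding n_def by (simp add: prod_eq_iff)
  have orth: "orthogonal x n" unfolding orthogonal_def n by (rule assms(1))
  have ne: "n \<noteq> x" using orth assms(2) by (auto simp: orthogonal_self)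
  have "pairwise orthogonal {n, x}"
    using orth by (auto simp: pairwise_insert orthogonal_commute)
  then have "independent {n, x}"
    by (rule pairwise_orthogonal_independent) (use assms(2) n0 in simp)
  then have "dim (span {n, x}) = 2"
    using ne by (simp add: dim_eq_card_independent)
  moreover have "sphere_tangent x = {y \<in> UNIV. \<forall>v\<in>span {n, x}. orthogonal v y}"
  proof -
    have "(\<forall>v\<in>span {n, x}. orthogonal v y) \<longleftrightarrow> y \<bullet> n = 0 \<and> y \<bullet> x = 0" for y
    proof
      assume "\<forall>v\<in>span {n, x}. orthogonal v y"
      moreover have "n \<in> span {n, x}" "x \<in> span {n, x}" by (auto intro: span_base)
      ultimately show "y \<bullet> n = 0 \<and> y \<bullet> x = 0"
        by (auto simp only: orthogonal_def inner_commute[of y])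
    next
      assume yn: "y \<bullet> n = 0 \<and> y \<bullet> x = 0"
      have "orthogonal y v" if "v \<in> span {n, x}" for v
        by (rule orthogonal_to_span[OF that]) (use yn in \<open>auto simp: orthogonal_def\<close>)
      then show "\<forall>v\<in>span {n, x}. orthogonal v y"
        by (simp only: orthogonal_commute[of _ y]) blast
    qed
    then show ?thesis unfolding sphere_tangent_def by (simp only: n) simp
  qed
  ultimately show "dim (sphere_tangent x) = 2"
    using dim_subspace_orthogonal_to_vectors[of "span {n, x}" UNIV] by simp
  show "subspace (sphere_tangent x)"
    unfolding sphere_tangent_def subspace_def by (auto simp: inner_add_left)
qed

lemma derivative_zero_of_locally_constant:
  assumes "(g has_derivative g') (at y)" "eventually (\<lambda>z. g z = k) (nhds y)"
  shows "g' u = 0"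
proof -
  obtain W where "open W \<and> y \<in> W \<and> (\<forall>z\<in>W. g z = k)"
    using iffD1[OF eventually_nhds assms(2)] by (elim exE) (rule that)
  then have "((\<lambda>_. k) has_derivative g') (at y)"
    using has_derivative_transform_within_open[of g g' y UNIV W "\<lambda>_. k"] assms(1) by auto
  then have "g' = (\<lambda>_. 0)"
    using has_derivative_const by (rule has_derivative_unique)
  then show ?thesis by simp
qed

text \<open>In an ambient chart a parametrization of \<open>S\<close> takes values with real \<open>x\<^sub>1\<close> and with norm in the
  discrete set of all \<open>2\<^sup>k \<surd>c\<close>. Both \<open>Im x\<^sub>1\<close> and the norm are therefore locally constant, so the
  derivative maps into the tangent plane; it is onto for dimension reasons.\<close>

lemma
  fixes b :: "(hopf_point, real ^ 2) patch"
  assumes b: "b \<in> submanifold_patches hopf_atlas (hopf_sphere c)" and "c > 0"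
    and a: "a \<in> hopf_atlas" and y: "y \<in> overlap b a"
  defines "x \<equiv> change b a y" and "D \<equiv> dchange b a y"
  shows sphere_patch_point: "x \<in> fst a" "x \<noteq> 0" "Im (fst x) = 0"
    and sphere_patch_open: "open (overlap b a)"
    and sphere_patch_derivative: "(change b a has_derivative D) (at y)"
    and sphere_patch_linear: "linear D" "inj D"
    and sphere_patch_range: "range D = sphere_tangent x"
proof -
  obtain V where V: "a = (V, hopf_proj)" "open V" "0 \<notin> V"
    using a unfolding hopf_atlas_def by auto
  define f where "f = change b a"
  have bS: "snd b ` fst b \<subseteq> hopf_sphere c" and op: "open (overlap b a)"
    and sm: "smooth_on (overlap b a) f" and inj: "inj D"
    using b a y unfolding submanifold_patches_def D_def f_def by auto
  have pt: "f z \<in> V \<and> hopf_proj (f z) \<in> hopf_sphere c" if "z \<in> overlap b a" for z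
    using that bS inv_into_into[of "snd b z" hopf_proj V] f_inv_into_f[of "snd b z" hopf_proj V]
    unfolding overlap_def f_def change_def V(1) by auto
  have xf: "x = f y" unfolding x_def f_def ..
  show xV: "x \<in> fst a" and x0: "x \<noteq> 0"
    using pt[OF y] V(3) by (auto simp: V(1) xf)
  have im: "Im (fst (f z)) = 0" if "z \<in> overlap b a" for z
    using hopf_sphere_lift(1) pt[OF that] \<open>c > 0\<close> by blast
  show imx: "Im (fst x) = 0" using im[OF y] unfolding xf .
  show "open (overlap b a)" by (rule op)
  have "Ck_on (Suc 0) (overlap b a) f" using sm unfolding smooth_on_def by blast
  then have "f differentiable (at y)" using y by simp
  then have der: "(f has_derivative D) (at y)"
    unfolding D_def dchange_def f_def[symmetric] by (simp add: frechet_derivative_works)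
  then show "(change b a has_derivative D) (at y)" unfolding f_def .
  show lin: "linear D" using der by (rule has_derivative_linear)
  show "inj D" by (rule inj)
  \<comment> \<open>By continuity the norm varies by a factor less than 2, and its values differ by powers of 2.\<close>
  have evU: "eventually (\<lambda>z. z \<in> overlap b a) (nhds y)"
    using op y by (rule eventually_nhds_in_open)
  have "isCont f y" using der by (rule has_derivative_continuous)
  then have tend: "((\<lambda>z. norm (f z)) \<longlongrightarrow> norm (f y)) (nhds y)"
    unfolding continuous_at by (intro tendsto_norm) (simp add: tendsto_nhds_iff)
  have "f y \<noteq> 0" using x0 unfolding xf .
  then have "eventually (\<lambda>z. norm (f z) < 2 * norm (f y)) (nhds y)"
    "eventually (\<lambda>z. norm (f y) / 2 < norm (f z)) (nhds y)"
    using order_tendstoD(2)[OF tend, of "2 * norm (f y)"]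
      order_tendstoD(1)[OF tend, of "norm (f y) / 2"] by simp_all
  with evU have norm_const: "eventually (\<lambda>z. f z \<bullet> f z = f y \<bullet> f y) (nhds y)"
  proof eventually_elim
    case (elim z)
    obtain k l :: int where k: "norm (f z) = 2 powi k * sqrt c" and l: "norm (f y) = 2 powi l * sqrt c"
      using hopf_sphere_lift(2) pt[OF elim(1)] pt[OF y] \<open>c > 0\<close> by blast
    have "norm (f z) = 2 powi (k - l) * norm (f y)"
      unfolding k l by (simp add: power_int_diff)
    then have "k - l = 0"
      using elim(2,3) \<open>f y \<noteq> 0\<close>
      by (intro powi_2_near_1) (auto simp: field_simps mult_less_cancel_left)
    then show ?case using k l by (simp add: dot_square_norm)
  qed
  have "D u \<in> sphere_tangent x" for u
  proof -
    have "((\<lambda>z. Im (fst (f z))) has_derivative (\<lambda>u. Im (fst (D u)))) (at y)"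
      by (auto intro!: derivative_eq_intros der)
    then have "Im (fst (D u)) = 0"
      by (rule derivative_zero_of_locally_constant)
         (use evU in eventually_elim, simp add: im y)
    moreover have "((\<lambda>z. f z \<bullet> f z) has_derivative (\<lambda>u. 2 * (D u \<bullet> f y))) (at y)"
      by (auto intro!: derivative_eq_intros der simp: inner_commute)
    then have "2 * (D u \<bullet> f y) = 0"
      using norm_const by (rule derivative_zero_of_locally_constant)
    ultimately show ?thesis unfolding sphere_tangent_def xf by simp
  qed
  moreover have "dim (range D) = 2"
    using dim_image_eq[of D UNIV] lin inj by simp
  ultimately show "range D = sphere_tangent x"
    using dim_sphere_tangent[OF imx x0] linear_subspace_image[OF lin subspace_UNIV]
    by (intro subspace_dim_equal) auto
qed

lemma gen_tangent_zero:
  assumes "range (dchange b a y) = sphere_tangent x"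
  shows "gen_tangent (\<lambda>_ _ _ _. 0) b a y = conormal_sum x"
  unfolding gen_tangent_def conormal_sum_def assms[symmetric] by auto

section \<open>The twist restricts to zero on a surface\<close>

lemma wedge12_wedge11_plane:
  fixes \<alpha> \<beta> \<gamma> :: "'e::real_vector \<Rightarrow> complex"
  assumes "linear \<alpha>" "linear \<beta>" "linear \<gamma>"
    and "u = u1 *\<^sub>R p + u2 *\<^sub>R q" "v = v1 *\<^sub>R p + v2 *\<^sub>R q" "w = w1 *\<^sub>R p + w2 *\<^sub>R q"
  shows "wedge12 \<alpha> (wedge11 \<beta> \<gamma>) u v w = 0"
proof -
  have *: "f (x *\<^sub>R p + y *\<^sub>R q) = of_real x * f p + of_real y * f q"
    if "linear f" for f :: "'e \<Rightarrow> complex" and x y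
    by (simp only: linear_add[OF that] linear_scale[OF that] scaleR_conv_of_real)
  show ?thesis
    unfolding wedge12_def wedge11_def assms(4-) assms(1-3)[THEN *] by algebra
qed

lemma hopf_H_zero_on_plane:
  fixes D :: "real ^ 2 \<Rightarrow> complex \<times> complex"
  assumes "linear D"
  shows "hopf_H x (D u) (D v) (D w) = 0"
proof -
  have D: "D u = (u $ 1) *\<^sub>R D (axis 1 1) + (u $ 2) *\<^sub>R D (axis 2 1)" for u
  proof -
    have "u = (u $ 1) *\<^sub>R axis 1 1 + (u $ 2) *\<^sub>R axis 2 1"
      by (simp add: vec_eq_iff forall_2 axis_def)
    from arg_cong[OF this, of D] show ?thesis
      by (simp only: linear_add[OF assms] linear_scale[OF assms])
  qed
  have l: "linear (fst :: complex \<times> complex \<Rightarrow> _)" "linear (snd :: complex \<times> complex \<Rightarrow> _)"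
    "linear (\<lambda>z::complex \<times> complex. cnj (fst z))" "linear (\<lambda>z::complex \<times> complex. cnj (snd z))"
    "linear (\<lambda>z. snd x * cnj (snd z) - cnj (snd x) * snd z)"
    "linear (\<lambda>z. fst x * cnj (fst z) - cnj (fst x) * fst z)"
    by (rule linearI; simp add: algebra_simps)+
  show ?thesis
    unfolding hopf_H_def hopf_H_complex_def
      wedge12_wedge11_plane[OF l(5,1,3) D D D] wedge12_wedge11_plane[OF l(6,2,4) D D D]
    by simp
qed

section \<open>Vanishing of the form of a brane\<close>

text \<open>Every \<open>\<iota>\<^sub>u G\<close> is the restriction of a covector \<open>\<xi>\<close> of the ambient space. The relation between
  \<open>D u + \<xi>\<close> and its image under \<open>J\<close>, whose vector part is tangent again, has right hand side zero
  on the plane, while the real part of its left hand side there is \<open>G u\<close>.\<close>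

lemma brane_form_zero_generic:
  fixes D :: "real ^ 2 \<Rightarrow> complex \<times> complex" and G :: "real ^ 2 \<Rightarrow> real ^ 2 \<Rightarrow> real"
  assumes J2: "\<And>s. blinfun_apply J (blinfun_apply J s) = - s"
    and L: "plus_i_eigenspace J = graph_form (hopf_C x)"
    and x: "Im (fst x) = 0" "snd x \<noteq> 0"
    and D: "linear D" "inj D" "range D = sphere_tangent x"
    and G: "\<And>u. linear (G u)"
    and inv: "\<And>s. \<exists>u. fst s = D u \<and> (\<forall>v. blinfun_apply (snd s) (D v) = G u v) \<Longrightarrow>
      fst (blinfun_apply J s) \<in> range D"
  shows "G u v = 0"
proof -
  obtain g where g: "linear g" "g \<circ> D = id"
    using linear_injective_left_inverse[OF D(1,2)] by blast
  define \<xi> where "\<xi> = Blinfun (\<lambda>w. G u (g w))"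
  have "linear (\<lambda>w. G u (g w))" using linear_compose[OF g(1) G] unfolding o_def .
  then have \<xi>: "blinfun_apply \<xi> (D v) = G u v" for v
    unfolding \<xi>_def using g(2)
    by (simp add: bounded_linear_Blinfun_apply linear_conv_bounded_linear pointfree_idE)
  have "fst (blinfun_apply J (D u, \<xi>)) \<in> sphere_tangent x"
    unfolding D(3)[symmetric] by (rule inv) (auto simp: \<xi>)
  moreover have "D u \<in> sphere_tangent x" "D v \<in> sphere_tangent x" using D(3) by auto
  ultimately have "hopf_C x (D u) (D v) = 0"
    "hopf_C x (fst (blinfun_apply J (D u, \<xi>))) (D v) = 0"
    using hopf_C_zero_on_sphere_tangent[OF x] by auto
  with graph_form_relation[OF J2 L, of "(D u, \<xi>)" "D v"] \<xi>[of v] show ?thesis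
    by (simp add: complex_eq_iff)
qed

text \<open>If \<open>x\<^sub>2\<close> vanished near \<open>y\<close>, the derivative would map into the tangent vectors with second
  component 0. At a point with \<open>x\<^sub>2 = 0\<close> the tangent plane is \<open>0 \<times> \<complex>\<close>, so the derivative would
  be 0 and not injective.\<close>

lemma sphere_patch_generic_dense:
  fixes b :: "(hopf_point, real ^ 2) patch"
  assumes "b \<in> submanifold_patches hopf_atlas (hopf_sphere c)" "c > 0"
    "a \<in> hopf_atlas" "y \<in> overlap b a"
  shows "\<exists>\<^sub>F z in nhds y. snd (change b a z) \<noteq> 0"
proof (rule ccontr)
  note pt = sphere_patch_point[OF assms]
  define x where "x = change b a y"
  assume "\<not> ?thesis"
  then have ev: "eventually (\<lambda>z. snd (change b a z) = 0) (nhds y)"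
    by (simp add: not_frequently)
  then have x2: "snd x = 0" unfolding x_def by (rule eventually_nhds_x_imp_x)
  have "snd (dchange b a y u) = 0" for u
  proof (rule derivative_zero_of_locally_constant[where g' = "\<lambda>u. snd (dchange b a y u)"])
    show "((\<lambda>z. snd (change b a z)) has_derivative (\<lambda>u. snd (dchange b a y u))) (at y)"
      by (rule has_derivative_snd[OF sphere_patch_derivative[OF assms]])
    show "eventually (\<lambda>z. snd (change b a z) = 0) (nhds y)" by (rule ev)
  qed
  moreover have "dchange b a y u \<in> sphere_tangent x" for u
    using sphere_patch_range[OF assms] unfolding x_def by auto
  ultimately have "dchange b a y u = 0" for u
    using pt(2,3) x2 unfolding x_def[symmetric] sphere_tangent_def
    by (auto simp: prod_eq_iff complex_eq_iff inner_prod_def inner_complex_def)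
  then have "axis 1 1 = (0 :: real ^ 2)" by (intro injD[OF sphere_patch_linear(2)[OF assms]]) simp
  then show False by simp
qed

section \<open>Existence and uniqueness of the brane\<close>

lemma two_form_on_linear:
  assumes "two_form_on B F" "b \<in> B" "y \<in> fst b"
  shows "linear (F b y u)"
  using assms(1)[unfolded two_form_on_def, THEN conjunct1, THEN bspec, OF assms(2), THEN conjunct1,
      THEN bspec, OF assms(3), THEN conjunct1] by (rule spec)

lemma two_form_on_isCont:
  assumes "two_form_on B F" "b \<in> B" "y \<in> fst b" "open (fst b)"
  shows "isCont (\<lambda>y. F b y u v) y"
proof -
  have "smooth_on (fst b) (\<lambda>y. F b y u v)"
    using assms(1)[unfolded two_form_on_def, THEN conjunct1, THEN bspec, OF assms(2),
        THEN conjunct2, THEN spec, THEN spec] .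
  then have "Ck_on 0 (fst b) (\<lambda>y. F b y u v)" unfolding smooth_on_def by (rule spec)
  then show ?thesis using assms(3,4) by (simp add: continuous_on_eq_continuous_at)
qed

lemma two_form_on_outside:
  assumes "two_form_on B F" "\<not> (b \<in> B \<and> y \<in> fst b)"
  shows "F b y u v = 0"
  using assms(1)[unfolded two_form_on_def, THEN conjunct2, THEN conjunct2, rule_format, of b y]
    assms(2) by blast

lemma zero_form_is_brane:
  fixes J :: "(hopf_point, complex \<times> complex) patch \<Rightarrow> complex \<times> complex \<Rightarrow>
                (complex \<times> complex) gtan \<Rightarrow>\<^sub>L (complex \<times> complex) gtan"
    and c :: real
  assumes gcs: "generalized_complex_structure hopf_atlas (\<lambda>_. hopf_H) J"
    and eigenbundle: "\<forall>a\<in>hopf_atlas. \<forall>x\<in>fst a. snd x \<noteq> 0 \<longrightarrow>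
                        plus_i_eigenspace (J a x) = graph_form (hopf_C x)"
    and "c > 0"
  shows "rank0_brane hopf_atlas (\<lambda>_. hopf_H) J (hopf_sphere c)
    (\<lambda>(b :: (hopf_point, real ^ 2) patch) y u v. 0)"
proof -
  let ?B = "submanifold_patches hopf_atlas (hopf_sphere c) :: (hopf_point, real ^ 2) patch set"
  note J2 = generalized_complex_structure_square[OF gcs]
  show ?thesis
    unfolding rank0_brane_def courant_trivialization_def
  proof (intro conjI ballI allI)
    show "two_form_on ?B (\<lambda>b y u v. 0)"
      unfolding two_form_on_def by (auto simp: smooth_on_def Ck_on_const linear_zero)
  next
    fix b a y u v w
    assume "b \<in> ?B" "a \<in> hopf_atlas" "y \<in> overlap b a"
    then show "d2 (\<lambda>y u v. 0) y u v w = hopf_H (change b a y)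
        (dchange b a y u) (dchange b a y v) (dchange b a y w)"
      using hopf_H_zero_on_plane[OF sphere_patch_linear(1)[OF _ \<open>c > 0\<close>]] by (simp add: d2_def)
  next
    fix b a y
    assume b: "b \<in> ?B" and a: "a \<in> hopf_atlas" and y: "y \<in> overlap b a"
    note pt = sphere_patch_point[OF b \<open>c > 0\<close> a y]
    let ?J = "blinfun_apply (J a (change b a y))" and ?T = "conormal_sum (change b a y)"
    have V: "open (fst a)" "0 \<notin> fst a" using a unfolding hopf_atlas_def by auto
    have inv: "?J s \<in> ?T" if "s \<in> ?T" for s
      using V generalized_complex_structure_continuous[OF gcs a] J2[OF a] eigenbundle[THEN bspec, OF a, rule_format] pt(1,3) that
      by (rule conormal_sum_invariant)
    have "s \<in> ?J ` ?T" if "s \<in> ?T" for s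
    proof
      show "s = ?J (?J (?J (?J s)))" by (simp only: J2[OF a pt(1)] minus_minus)
      show "?J (?J (?J s)) \<in> ?T" by (intro inv that)
    qed
    with inv show "?J ` gen_tangent (\<lambda>b y u v. 0) b a y = gen_tangent (\<lambda>b y u v. 0) b a y"
      unfolding gen_tangent_zero[OF sphere_patch_range[OF b \<open>c > 0\<close> a y]] by auto
  qed
qed

lemma brane_form_is_zero:
  fixes J :: "(hopf_point, complex \<times> complex) patch \<Rightarrow> complex \<times> complex \<Rightarrow>
                (complex \<times> complex) gtan \<Rightarrow>\<^sub>L (complex \<times> complex) gtan"
    and c :: real
    and F :: "(hopf_point, real ^ 2) patch \<Rightarrow> real ^ 2 \<Rightarrow> real ^ 2 \<Rightarrow> real ^ 2 \<Rightarrow> real"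
  assumes gcs: "generalized_complex_structure hopf_atlas (\<lambda>_. hopf_H) J"
    and eigenbundle: "\<forall>a\<in>hopf_atlas. \<forall>x\<in>fst a. snd x \<noteq> 0 \<longrightarrow>
                        plus_i_eigenspace (J a x) = graph_form (hopf_C x)"
    and "c > 0"
    and F: "rank0_brane hopf_atlas (\<lambda>_. hopf_H) J (hopf_sphere c) F"
  shows "F = (\<lambda>b y u v. 0)"
proof -
  let ?B = "submanifold_patches hopf_atlas (hopf_sphere c) :: (hopf_point, real ^ 2) patch set"
  have form: "two_form_on ?B F"
    and inv: "\<And>b a y. b \<in> ?B \<Longrightarrow> a \<in> hopf_atlas \<Longrightarrow> y \<in> overlap b a \<Longrightarrow>
      blinfun_apply (J a (change b a y)) ` gen_tangent F b a y = gen_tangent F b a y"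
    using F unfolding rank0_brane_def courant_trivialization_def by simp_all
  note J2 = generalized_complex_structure_square[OF gcs]
  have generic: "F b z u v = 0"
    if b: "b \<in> ?B" and a: "a \<in> hopf_atlas" and z: "z \<in> overlap b a"
      and "snd (change b a z) \<noteq> 0" for b a z u v
  proof -
    note pt = sphere_patch_point[OF b \<open>c > 0\<close> a z]
      and D = sphere_patch_linear[OF b \<open>c > 0\<close> a z] sphere_patch_range[OF b \<open>c > 0\<close> a z]
    have lin: "linear (F b z u)" for u
      using two_form_on_linear[OF form b] z unfolding overlap_def by simp
    have step: "fst (blinfun_apply (J a (change b a z)) s) \<in> range (dchange b a z)"
      if "\<exists>u. fst s = dchange b a z u \<and> (\<forall>v. blinfun_apply (snd s) (dchange b a z v) = F b z u v)"
      for s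
    proof -
      have "s \<in> gen_tangent F b a z" using that unfolding gen_tangent_def by (cases s) auto
      then have "blinfun_apply (J a (change b a z)) s \<in> gen_tangent F b a z"
        using inv[OF b a z] by (metis imageI)
      then show ?thesis unfolding gen_tangent_def by auto
    qed
    have "plus_i_eigenspace (J a (change b a z)) = graph_form (hopf_C (change b a z))"
      using eigenbundle[THEN bspec, OF a, rule_format] pt(1) that(4) .
    then show ?thesis
      by (rule brane_form_zero_generic[OF J2[OF a pt(1)] _ pt(3) that(4) D lin step])
  qed
  have "F b y u v = 0" for b y u v
  proof (cases "b \<in> ?B \<and> y \<in> fst b")
    case False
    then show ?thesis by (rule two_form_on_outside[OF form])
  next
    case True
    then have b: "b \<in> ?B" and y: "y \<in> fst b" by auto
    have "snd b y \<in> hopf_sphere c" "open (fst b)"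
      using b y unfolding submanifold_patches_def by auto
    moreover have "hopf_sphere c \<subseteq> hopf_surface"
      using \<open>c > 0\<close> unfolding hopf_sphere_def hopf_surface_def
      by (auto simp: hopf_R2_def)
    ultimately have "snd b y \<in> (\<Union>a\<in>hopf_atlas. snd a ` fst a)"
      using smooth_atlas_hopf[unfolded smooth_atlas_def, THEN conjunct2, THEN conjunct1] by auto
    then obtain a where a: "a \<in> hopf_atlas" "snd b y \<in> snd a ` fst a"
      by (elim UN_E)
    then have ya: "y \<in> overlap b a" using y unfolding overlap_def by simp
    have cont: "isCont (\<lambda>y. F b y u v) y"
      by (rule two_form_on_isCont[OF form b y \<open>open (fst b)\<close>])
    show ?thesis
    proof (rule ccontr)
      assume "F b y u v \<noteq> 0"
      then have "eventually (\<lambda>z. F b z u v \<noteq> 0) (nhds y)"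
        using cont unfolding continuous_at by (simp add: tendsto_nhds_iff tendsto_imp_eventually_ne)
      moreover have "eventually (\<lambda>z. z \<in> overlap b a) (nhds y)"
        using sphere_patch_open[OF b \<open>c > 0\<close> a(1) ya] ya by (rule eventually_nhds_in_open)
      ultimately have "eventually (\<lambda>z. snd (change b a z) = 0) (nhds y)"
      proof eventually_elim
        case (elim z)
        then show ?case using generic[OF b a(1)] by metis
      qed
      then show False
        using sphere_patch_generic_dense[OF b \<open>c > 0\<close> a(1) ya] by (simp add: frequently_def)
    qed
  qed
  then show ?thesis by (intro ext)
qed

theorem proposition7p1:
  fixes J :: "(hopf_point, complex \<times> complex) patch \<Rightarrow> complex \<times> complex \<Rightarrow>
                (complex \<times> complex) gtan \<Rightarrow>\<^sub>L (complex \<times> complex) gtan"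
    and c :: real
  assumes gcs: "generalized_complex_structure hopf_atlas (\<lambda>_. hopf_H) J"
    and eigenbundle: "\<forall>a\<in>hopf_atlas. \<forall>x\<in>fst a. snd x \<noteq> 0 \<longrightarrow>
                        plus_i_eigenspace (J a x) = graph_form (hopf_C x)"
    and "c > 0"
  shows "\<exists>!F :: (hopf_point, real ^ 2) patch \<Rightarrow> real ^ 2 \<Rightarrow> real ^ 2 \<Rightarrow> real ^ 2 \<Rightarrow> real.
           rank0_brane hopf_atlas (\<lambda>_. hopf_H) J (hopf_sphere c) F"
proof (rule ex1I)
  show "rank0_brane hopf_atlas (\<lambda>_. hopf_H) J (hopf_sphere c)
      (\<lambda>(b :: (hopf_point, real ^ 2) patch) y u v. 0)"
    by (rule zero_form_is_brane[OF assms])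
qed (rule brane_form_is_zero[OF assms])

end
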